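(* Let $I=(X,\mathcal{D},R)$ be a binary CSP instance and let $b \in \mathcal{D}(x_i)$ for some variable $x_i$ of $I$. If $b$ is snake-substitutable (by some other value $a\in\mathcal{D}(x_i)$, $a\neq b$) or $b$ is conditioned neighbourhood-substitutable, then $b$ can be eliminated from $\mathcal{D}(x_i)$ without changing the satisfiability of the instance; that is, $I$ has a solution if and only if the instance obtained from $I$ by replacing $\mathcal{D}(x_i)$ by $\mathcal{D}(x_i)\setminus\{b\}$ (and restricting the constraint relations accordingly) has a solution.
   Context: A binary CSP instance $I=(X,\mathcal{D},R)$ consists of a set $X$ of $n$ variables $x_1,\ldots,x_n$, a finite domain $\mathcal{D}(x_i)$ for each variable $x_i$, and a binary constraint relation $R_{ij} \subseteq \mathcal{D}(x_i)\times\mathcal{D}(x_j)$ for each pair of distinct variables $x_i,x_j$, where $R_{ji}$ is always the transpose of $R_{ij}$. If $x_i$ and $x_j$ do not constrain each other then $R_{ij}=\mathcal{D}(x_i)\times\mathcal{D}(x_j)$. A solution is an $n$-tuple $\langle s_1,\ldots,s_n\rangle$ with $s_i\in\mathcal{D}(x_i)$ for all $i$ and $(s_i,s_j)\in R_{ij}$ for all distinct $i,j$. An instance is satisfiable if it has a solution. Indices such as $j,k,\ell$ range over $\{1,\ldots,n\}$. For $a,b\in\mathcal{D}(x_i)$ and $j\neq i$, write $b \xrightarrow{ij} a$ if for all $c\in\mathcal{D}(x_j)$, $(b,c)\in R_{ij}$ implies $(a,c)\in R_{ij}$. For $a,b\in\mathcal{D}(x_i)$ and $k\neq i$, write $b \overset{ik}{\rightsquigarrow}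 a$ if for all $d\in\mathcal{D}(x_k)$ with $(b,d)\in R_{ik}$ there exists $e\in\mathcal{D}(x_k)$ such that $(a,e)\in R_{ik}$ and, for all $\ell\notin\{i,k\}$, $d\xrightarrow{k\ell} e$. Given two (distinct) values $a,b\in\mathcal{D}(x_i)$, $b$ is snake substitutable (SS) by $a$ if for all $k\neq i$, $b\overset{ik}{\rightsquigarrow}a$. A value $b\in\mathcal{D}(x_i)$ is conditioned neighbourhood-substitutable (CNS) if for some $j\neq i$, for all $c\in\mathcal{D}(x_j)$ with $(b,c)\in R_{ij}$, there exists $a\in\mathcal{D}(x_i)\setminus\{b\}$ such that $(a,c)\in R_{ij}$ and, for all $k\notin\{i,j\}$, $b\xrightarrow{ik}a$. *)

theory Defs
  imports Main "HOL-Library.FuncSet"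
begin

text \<open>
  The variable \<open>x\<^sub>i\<close> is represented by its index \<open>i \<in> {1..n}\<close>. All domains are subsets of one
  type of values; they may be different, disjoint, overlapping or empty. The values of the fields
  outside the index range, and of the constraint field on the diagonal, are irrelevant.
\<close>

record 'a csp =
  nvars :: nat
  dom_of :: "nat \<Rightarrow> 'a set"
  rel_of :: "nat \<Rightarrow> nat \<Rightarrow> ('a \<times> 'a) set"

definition vars :: "'a csp \<Rightarrow> nat set" where
  "vars I = {1..nvars I}"

definition binary_csp :: "'a csp \<Rightarrow> bool" where
  "binary_csp I \<longleftrightarrow>
     (\<forall>i\<in>vars I. finite (dom_of I i)) \<and>
     (\<forall>i\<in>vars I. \<forall>j\<in>vars I. i \<noteq> j \<longrightarrow>
        rel_of I i j \<subseteq> dom_of I i \<times> dom_of I j \<and> rel_of I j i = (rel_of I i j)\<inverse>)"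

text \<open>An \<open>n\<close>-tuple is a function on \<open>{1..n}\<close>, extended by \<open>undefined\<close> elsewhere.\<close>

definition solution :: "'a csp \<Rightarrow> (nat \<Rightarrow> 'a) \<Rightarrow> bool" where
  "solution I s \<longleftrightarrow>
     s \<in> (\<Pi>\<^sub>E i\<in>vars I. dom_of I i) \<and>
     (\<forall>i\<in>vars I. \<forall>j\<in>vars I. i \<noteq> j \<longrightarrow> (s i, s j) \<in> rel_of I i j)"

definition satisfiable :: "'a csp \<Rightarrow> bool" where
  "satisfiable I \<longleftrightarrow> (\<exists>s. solution I s)"

text \<open>
  \<open>arrow I i j b a\<close> and \<open>snake I i k b a\<close> stand for the straight arrow (superscript \<open>ij\<close>) and the
  wavy arrow (superscript \<open>ik\<close>) from \<open>b\<close> to \<open>a\<close>. They are meant for \<open>a\<close> and \<open>b\<close> in the domain of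
  \<open>x\<^sub>i\<close> and distinct variables; the notions using them impose these conditions.
\<close>

definition arrow :: "'a csp \<Rightarrow> nat \<Rightarrow> nat \<Rightarrow> 'a \<Rightarrow> 'a \<Rightarrow> bool" where
  "arrow I i j b a \<longleftrightarrow>
     (\<forall>c\<in>dom_of I j. (b, c) \<in> rel_of I i j \<longrightarrow> (a, c) \<in> rel_of I i j)"

definition snake :: "'a csp \<Rightarrow> nat \<Rightarrow> nat \<Rightarrow> 'a \<Rightarrow> 'a \<Rightarrow> bool" where
  "snake I i k b a \<longleftrightarrow>
     (\<forall>d\<in>dom_of I k. (b, d) \<in> rel_of I i k \<longrightarrow>
        (\<exists>e\<in>dom_of I k. (a, e) \<in> rel_of I i k \<and>
           (\<forall>l\<in>vars I - {i, k}. arrow I k l d e)))"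

definition snake_substitutable :: "'a csp \<Rightarrow> nat \<Rightarrow> 'a \<Rightarrow> 'a \<Rightarrow> bool" where
  "snake_substitutable I i b a \<longleftrightarrow>
     a \<in> dom_of I i \<and> b \<in> dom_of I i \<and> a \<noteq> b \<and>
     (\<forall>k\<in>vars I - {i}. snake I i k b a)"

definition conditioned_neighbourhood_substitutable :: "'a csp \<Rightarrow> nat \<Rightarrow> 'a \<Rightarrow> bool" where
  "conditioned_neighbourhood_substitutable I i b \<longleftrightarrow>
     b \<in> dom_of I i \<and>
     (\<exists>j\<in>vars I - {i}. \<forall>c\<in>dom_of I j. (b, c) \<in> rel_of I i j \<longrightarrow>
        (\<exists>a\<in>dom_of I i - {b}. (a, c) \<in> rel_of I i j \<and>
           (\<forall>k\<in>vars I - {i, j}. arrow I i k b a)))"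

definition restrict_csp :: "'a csp \<Rightarrow> (nat \<Rightarrow> 'a set) \<Rightarrow> 'a csp" where
  "restrict_csp I D =
     I\<lparr>dom_of := D, rel_of := (\<lambda>j k. rel_of I j k \<inter> (D j \<times> D k))\<rparr>"

definition eliminate :: "'a csp \<Rightarrow> nat \<Rightarrow> 'a \<Rightarrow> 'a csp" where
  "eliminate I i b = restrict_csp I ((dom_of I)(i := dom_of I i - {b}))"

lemma binary_csp_eliminate:
  assumes "binary_csp I"
  shows "binary_csp (eliminate I i b)"
proof -
  define D where "D = (dom_of I)(i := dom_of I i - {b})"
  have sel: "vars (eliminate I i b) = vars I" "dom_of (eliminate I i b) = D"
    "\<And>j k. rel_of (eliminate I i b) j k = rel_of I j k \<inter> (D j \<times> D k)"
    by (simp_all add: eliminate_def restrict_csp_def vars_def D_def)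
  show ?thesis
    unfolding binary_csp_def sel
  proof (intro conjI ballI impI)
    fix j assume "j \<in> vars I"
    then have "finite (dom_of I j)"
      using assms unfolding binary_csp_def by blast
    then show "finite (D j)"
      unfolding D_def by (cases "j = i") simp_all
  next
    fix j k
    show "rel_of I j k \<inter> (D j \<times> D k) \<subseteq> D j \<times> D k"
      by blast
    assume "j \<in> vars I" "k \<in> vars I" "j \<noteq> k"
    then have "rel_of I k j = (rel_of I j k)\<inverse>"
      using assms unfolding binary_csp_def by blast
    then show "rel_of I k j \<inter> (D k \<times> D j) = (rel_of I j k \<inter> (D j \<times> D k))\<inverse>"
      by blast
  qed
qed

end

theory Submission
  imports Defs
begin

text \<open>
  A solution that assigns \<open>b\<close> to \<open>x\<^sub>i\<close> is repaired into one that does not. Under CNS only the value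
  of \<open>x\<^sub>i\<close> changes. Under SS by \<open>a\<close>, \<open>x\<^sub>i\<close> receives \<open>a\<close> and simultaneously every other value \<open>s\<^sub>k\<close> is
  replaced by the witness \<open>e\<^sub>k\<close> of the wavy arrow for \<open>d = s\<^sub>k\<close>; the constraint between \<open>x\<^sub>k\<close> and
  \<open>x\<^sub>l\<close> survives because the two replacements can be performed one after the other.
\<close>

lemma rel_of_commute:
  assumes "binary_csp I" "j \<in> vars I" "k \<in> vars I" "j \<noteq> k"
  shows "(x, y) \<in> rel_of I j k \<longleftrightarrow> (y, x) \<in> rel_of I k j"
  using assms unfolding binary_csp_def by blast

text \<open>Intersecting the relations with the smaller domains adds no condition, since a tuple
  already takes its values in those domains. Hence elimination amounts to looking for solutions of
  \<open>I\<close> itself that avoid \<open>b\<close> at \<open>i\<close>.\<close>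

lemma solution_eliminate_iff:
  assumes "i \<in> vars I"
  shows "solution (eliminate I i b) s \<longleftrightarrow> solution I s \<and> s i \<noteq> b"
proof -
  have sel: "vars (eliminate I i b) = vars I"
    "dom_of (eliminate I i b) = (dom_of I)(i := dom_of I i - {b})"
    "\<And>j k. rel_of (eliminate I i b) j k = rel_of I j k \<inter>
      (((dom_of I)(i := dom_of I i - {b})) j \<times> ((dom_of I)(i := dom_of I i - {b})) k)"
    by (simp_all add: eliminate_def restrict_csp_def vars_def)
  show ?thesis
    unfolding solution_def sel using assms by (auto simp: PiE_iff)
qed

text \<open>Since \<open>rel_of I k i\<close> is the transpose of \<open>rel_of I i k\<close>,
  constraints at the modified variable need checking in one orientation only. Both repairs use this
  split.\<close>

lemma solutionI_pivot:
  assumes "binary_csp I" "i \<in> vars I" "s \<in> (\<Pi>\<^sub>E j\<in>vars I. dom_of I j)"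
    and "\<And>k. k \<in> vars I \<Longrightarrow> k \<noteq> i \<Longrightarrow> (s i, s k) \<in> rel_of I i k"
    and "\<And>j k. j \<in> vars I \<Longrightarrow> k \<in> vars I \<Longrightarrow> j \<noteq> i \<Longrightarrow> k \<noteq> i \<Longrightarrow> j \<noteq> k \<Longrightarrow>
      (s j, s k) \<in> rel_of I j k"
  shows "solution I s"
  unfolding solution_def using assms rel_of_commute[OF assms(1)] by metis

lemma conditioned_neighbourhood_substitutable_repair:
  assumes I: "binary_csp I" and i: "i \<in> vars I"
    and cns: "conditioned_neighbourhood_substitutable I i (s i)" and s: "solution I s"
  shows "\<exists>t. solution I t \<and> t i \<noteq> s i"
proof -
  have dom: "s k \<in> dom_of I k" if "k \<in> vars I" for k
    using s that unfolding solution_def by blast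
  have rel: "(s k, s l) \<in> rel_of I k l" if "k \<in> vars I" "l \<in> vars I" "k \<noteq> l" for k l
    using s that unfolding solution_def by blast
  obtain j where j: "j \<in> vars I" "j \<noteq> i"
    and cond: "\<forall>c\<in>dom_of I j. (s i, c) \<in> rel_of I i j \<longrightarrow>
      (\<exists>a\<in>dom_of I i - {s i}. (a, c) \<in> rel_of I i j \<and>
        (\<forall>k\<in>vars I - {i, j}. arrow I i k (s i) a))"
    using cns unfolding conditioned_neighbourhood_substitutable_def by blast
  \<comment> \<open>The CNS condition is instantiated at \<open>c = s j\<close>, so the substitute
    \<open>a\<close> depends on the solution being repaired.\<close>
  have "(s i, s j) \<in> rel_of I i j"
    using rel i j by blast
  then obtain a where a: "a \<in> dom_of I i" "a \<noteq> s i" "(a, s j) \<in> rel_of I i j"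
    and arr: "\<And>k. k \<in> vars I - {i, j} \<Longrightarrow> arrow I i k (s i) a"
    using cond dom j(1) by blast
  have "solution I (s(i := a))"
  proof (rule solutionI_pivot[OF I i])
    show "s(i := a) \<in> (\<Pi>\<^sub>E j\<in>vars I. dom_of I j)"
      using s a i unfolding solution_def by (auto simp: PiE_iff extensional_def)
  next
    fix k assume k: "k \<in> vars I" "k \<noteq> i"
    have "(a, s k) \<in> rel_of I i k"
    \<comment> \<open>No arrow towards \<open>j\<close> is available; there the choice of
      \<open>a\<close> for \<open>s j\<close> gives compatibility directly.\<close>
    proof (cases "k = j")
      case False
      then show ?thesis
        using arr[of k] dom rel i k unfolding arrow_def by blast
    qed (use a in simp)
    then show "((s(i := a)) i, (s(i := a)) k) \<in> rel_of I i k"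
      using k by simp
  next
    fix k l assume "k \<in> vars I" "l \<in> vars I" "k \<noteq> i" "l \<noteq> i" "k \<noteq> l"
    then show "((s(i := a)) k, (s(i := a)) l) \<in> rel_of I k l"
      using rel by simp
  qed
  then show ?thesis
    using a(2) by (intro exI[of _ "s(i := a)"]) simp
qed

lemma snake_substitutable_repair:
  assumes I: "binary_csp I" and i: "i \<in> vars I"
    and ss: "snake_substitutable I i (s i) a" and s: "solution I s"
  shows "\<exists>t. solution I t \<and> t i \<noteq> s i"
proof -
  have dom: "s k \<in> dom_of I k" if "k \<in> vars I" for k
    using s that unfolding solution_def by blast
  have rel: "(s k, s l) \<in> rel_of I k l" if "k \<in> vars I" "l \<in> vars I" "k \<noteq> l" for k l
    using s that unfolding solution_def by blast
  have a: "a \<in> dom_of I i" "a \<noteq> s i"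
    using ss unfolding snake_substitutable_def by auto
  have "\<forall>k\<in>vars I - {i}. \<exists>e. e \<in> dom_of I k \<and> (a, e) \<in> rel_of I i k \<and>
      (\<forall>l\<in>vars I - {i, k}. arrow I k l (s k) e)"
  proof
    fix k assume k: "k \<in> vars I - {i}"
    then have "snake I i k (s i) a"
      using ss unfolding snake_substitutable_def by blast
    moreover have "s k \<in> dom_of I k" "(s i, s k) \<in> rel_of I i k"
      using k i dom rel by auto
    ultimately show "\<exists>e. e \<in> dom_of I k \<and> (a, e) \<in> rel_of I i k \<and>
        (\<forall>l\<in>vars I - {i, k}. arrow I k l (s k) e)"
      unfolding snake_def by blast
  qed
  \<comment> \<open>Each \<open>e k\<close> is chosen from \<open>s k\<close> alone, independently
    of the other choices.\<close>
  from bchoice[OF this] obtain e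
    where e: "\<And>k. k \<in> vars I - {i} \<Longrightarrow> e k \<in> dom_of I k"
      "\<And>k. k \<in> vars I - {i} \<Longrightarrow> (a, e k) \<in> rel_of I i k"
      and arr: "\<And>k l. k \<in> vars I - {i} \<Longrightarrow> l \<in> vars I - {i, k} \<Longrightarrow> arrow I k l (s k) (e k)"
    by blast
  define t where "t = restrict (e(i := a)) (vars I)"
  have t: "t i = a" "\<And>k. k \<in> vars I \<Longrightarrow> k \<noteq> i \<Longrightarrow> t k = e k"
    using i by (simp_all add: t_def)
  have "solution I t"
  proof (rule solutionI_pivot[OF I i])
    show "t \<in> (\<Pi>\<^sub>E j\<in>vars I. dom_of I j)"
      using a e(1) unfolding t_def by auto
  next
    fix k assume "k \<in> vars I" "k \<noteq> i"
    then show "(t i, t k) \<in> rel_of I i k"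
      using t e(2) by simp
  next
    fix k l assume kl: "k \<in> vars I" "l \<in> vars I" "k \<noteq> i" "l \<noteq> i" "k \<noteq> l"
    have "arrow I k l (s k) (e k)" "arrow I l k (s l) (e l)"
      using arr kl by auto
    note arr_kl = this[unfolded arrow_def]
    \<comment> \<open>First \<open>s k\<close> is replaced against the old value \<open>s l\<close>.
      The arrow from \<open>s l\<close> to \<open>e l\<close> is then applied to the new value
      \<open>e k\<close>, which is legitimate because arrows quantify over the whole domain of the
      other variable.\<close>
    have "(e k, s l) \<in> rel_of I k l"
      using arr_kl(1) dom rel kl by blast
    then have "(s l, e k) \<in> rel_of I l k"
      using rel_of_commute[OF I] kl by blast
    then have "(e l, e k) \<in> rel_of I l k"
      using arr_kl(2) e(1) kl by blast
    then show "(t k, t l) \<in> rel_of I k l"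
      using rel_of_commute[OF I] kl t by simp
  qed
  then show ?thesis
    using a(2) t(1) by blast
qed

theorem corollary1:
  fixes I :: "'a csp" and i :: nat and b :: 'a
  assumes "binary_csp I"
    and "i \<in> vars I"
    and "b \<in> dom_of I i"
    and "(\<exists>a\<in>dom_of I i. a \<noteq> b \<and> snake_substitutable I i b a) \<or> conditioned_neighbourhood_substitutable I i b"
  shows "satisfiable I \<longleftrightarrow> satisfiable (eliminate I i b)"
proof
  assume "satisfiable I"
  then obtain s where s: "solution I s"
    unfolding satisfiable_def by blast
  have "\<exists>t. solution I t \<and> t i \<noteq> b"
  proof (cases "s i = b")
    case True
    then show ?thesis
      using assms s snake_substitutable_repair[of I i s]
        conditioned_neighbourhood_substitutable_repair[of I i s] by blast
  qed (use s in blast)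
  then show "satisfiable (eliminate I i b)"
    unfolding satisfiable_def solution_eliminate_iff[OF assms(2)] .
next
  assume "satisfiable (eliminate I i b)"
  then show "satisfiable I"
    unfolding satisfiable_def solution_eliminate_iff[OF assms(2)] by blast
qed

end
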